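(* Let $(\mu_1,\mu_2)$ and $(\phi_1,\phi_2)$ be two systems of univariate measures, and consider the bivariate system of products $(\mu_1\phi_1,\mu_1\phi_2,\mu_2\phi_1,\mu_2\phi_2)$. Let $\vec n=(n_1,n_2)\in\mathbb{N}^2$ and $\vec m=(m_1,m_2)\in\mathbb{N}^2$ be normal multi-indices for the systems $(\mu_1,\mu_2)$ and $(\phi_1,\phi_2)$, respectively. Define $$\tilde v=(\tilde v_{ij})=\big(\pi(n_1,m_1),\pi(n_1,m_2),\pi(n_2,m_1),\pi(n_2,m_2)\big).$$ Then it is always possible to find a multi-index $\vec v\in\mathbb{N}^4$ such that $|\vec v|=\pi(|\vec n|,|\vec m|)$ and $\vec v\le\tilde v$ componentwise.
   Context: Here $\mathbb{N}=\{0,1,2,\dots\}$, the modulus $|\cdot|$ of a multi-index is the sum of its components, and $\pi:\mathbb{N}^2\to\mathbb{N}$, $\pi(t,s)=\frac12(t+s)(t+s+1)+s$, is the Cantor pairing function. A multi-index $\vec n=(n_1,n_2)$ is normal for a system $(\mu_1,\mu_2)$ of measures on $\mathbb{R}$ with finite moments if there is a unique monic polynomial $P$ of degree $|\vec n|$ with $\int P(x)x^k\,d\mu_j(x)=0$ for $k=0,\dots,n_j-1$ and $j=1,2$. Equivalently, the $|\vec n|\times|\vec n|$ matrix obtained by stacking the $n_j\times|\vec n|$ blocks with $(a,b)$ entry (from $0$) $\int x^{a+b}\,d\mu_j(x)$, $j=1,2$, is regular. The measures $\mu_i\phi_j$ are the product measures $\mu_i(x)\times\phi_j(y)$ on $\mathbb{R}^2$.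 *)

theory Defs
  imports "HOL-Analysis.Analysis" "HOL-Computational_Algebra.Polynomial" "HOL-Library.Nat_Bijection"
begin

text \<open>
  A system of measures and a multi-index for it are functions on the same finite index type:
  \<^typ>\<open>2\<close> for a pair of univariate measures, \<^typ>\<open>2 \<times> 2\<close> for the four products of
  two such pairs.
\<close>

definition modulus :: "('i::finite \<Rightarrow> nat) \<Rightarrow> nat" where
  "modulus n = (\<Sum>i\<in>UNIV. n i)"

definition cantor_pair :: "nat \<Rightarrow> nat \<Rightarrow> nat" where
  "cantor_pair t s = (t + s) * (t + s + 1) div 2 + s"

text \<open>The library's pairing function is this one with the arguments exchanged.\<close>

lemma cantor_pair_eq_prod_encode: "cantor_pair t s = prod_encode (s, t)"
  by (simp add: cantor_pair_def prod_encode_def triangle_def add.commute)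

definition moment_system :: "('i::finite \<Rightarrow> real measure) \<Rightarrow> bool" where
  "moment_system \<mu> \<longleftrightarrow>
    (\<forall>j. sets (\<mu> j) = sets borel \<and> (\<forall>k. integrable (\<mu> j) (\<lambda>x. x ^ k)))"

definition normal_index :: "('i::finite \<Rightarrow> real measure) \<Rightarrow> ('i \<Rightarrow> nat) \<Rightarrow> bool" where
  "normal_index \<mu> n \<longleftrightarrow>
    (\<exists>!P :: real poly. lead_coeff P = 1 \<and> degree P = modulus n \<and>
      (\<forall>j. \<forall>k < n j. (\<integral>x. poly P x * x ^ k \<partial>\<mu> j) = 0))"

definition product_system ::
  "('i::finite \<Rightarrow> real measure) \<Rightarrow> ('j::finite \<Rightarrow> real measure) \<Rightarrow> 'i \<times> 'j \<Rightarrow> (real \<times> real) measure"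
where
  "product_system \<mu> \<phi> = (\<lambda>(i, j). \<mu> i \<Otimes>\<^sub>M \<phi> j)"

end

theory Submission imports Defs begin

text \<open>
  A multi-index of prescribed modulus exists below a given one as soon as the modulus does not
  exceed that of the bound (\<open>exists_bounded_with_sum\<close>), so the claim reduces to the inequality
  \<open>\<pi>(|n|, |m|) \<le> \<Sum>i j. \<pi>(n i, m j)\<close>.  Write \<open>2 \<pi>(t, s) = (t + s)\<^sup>2 + t + 3 s\<close>.
  In twice the difference of the two sides the mixed terms \<open>2 |n| |m|\<close> cancel, and there remains
  \<open>(n\<^sub>1 - n\<^sub>2)\<^sup>2 + (m\<^sub>1 - m\<^sub>2)\<^sup>2 + |n| + 3 |m|\<close>, which is nonnegative
  (\<open>cantor_pair_add_le\<close>).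
\<close>

lemma exists_bounded_with_sum:
  fixes f :: "'a \<Rightarrow> nat"
  assumes "finite A" and "k \<le> sum f A"
  shows "\<exists>g. sum g A = k \<and> (\<forall>x. g x \<le> f x)"
  using assms
proof (induction A arbitrary: k rule: finite_induct)
  case empty
  then show ?case by (intro exI[of _ "\<lambda>_. 0"]) auto
next
  case (insert a A)
  \<comment> \<open>The greedy choice: \<open>a\<close> takes as much of \<open>k\<close> as its bound permits.\<close>
  have "k - min k (f a) \<le> sum f A"
    using insert.prems insert.hyps by simp
  from insert.IH[OF this] obtain g
    where g: "sum g A = k - min k (f a)" "\<forall>x. g x \<le> f x" by blast
  have "sum (g(a := min k (f a))) A = sum g A"
    using insert.hyps by (intro sum.cong) auto
  then have "sum (g(a := min k (f a))) (insert a A) = k"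
    using insert.hyps g(1) by simp
  moreover have "\<forall>x. (g(a := min k (f a))) x \<le> f x"
    using g(2) by simp
  ultimately show ?case by blast
qed

lemma double_cantor_pair: "2 * cantor_pair t s = (t + s)\<^sup>2 + t + 3 * s"
proof -
  have "2 * ((t + s) * (t + s + 1) div 2) = (t + s) * (t + s + 1)"
    by (intro dvd_mult_div_cancel) simp
  then show ?thesis
    by (simp add: cantor_pair_def power2_eq_square algebra_simps)
qed

lemma cantor_pair_add_le:
  "cantor_pair (a + b) (c + d)
    \<le> cantor_pair a c + cantor_pair a d + cantor_pair b c + cantor_pair b d"
proof -
  have two: "2 * int (cantor_pair t s) = (int t + int s)\<^sup>2 + int t + 3 * int s" for t s
    using arg_cong[OF double_cantor_pair[of t s], of int] by simp
  have "2 * (int (cantor_pair a c) + int (cantor_pair a d)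
        + int (cantor_pair b c) + int (cantor_pair b d) - int (cantor_pair (a + b) (c + d)))
      = (int a - int b)\<^sup>2 + (int c - int d)\<^sup>2 + (int a + int b) + 3 * (int c + int d)"
    unfolding distrib_left right_diff_distrib two
    by (simp add: power2_eq_square algebra_simps)
  also have "\<dots> \<ge> 0" by simp
  finally have "int (cantor_pair (a + b) (c + d))
      \<le> int (cantor_pair a c + cantor_pair a d + cantor_pair b c + cantor_pair b d)"
    by simp
  then show ?thesis by (simp only: of_nat_le_iff)
qed

theorem proposition5p1:
  fixes \<mu> \<phi> :: "2 \<Rightarrow> real measure"
    and \<nu> :: "2 \<times> 2 \<Rightarrow> (real \<times> real) measure"
    and n m :: "2 \<Rightarrow> nat"
    and vt :: "2 \<times> 2 \<Rightarrow> nat"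
  assumes "moment_system \<mu>" and "moment_system \<phi>"
    and "\<nu> = product_system \<mu> \<phi>"
    and "normal_index \<mu> n" and "normal_index \<phi> m"
    and "\<And>i j. vt (i, j) = cantor_pair (n i) (m j)"
  shows "\<exists>v :: 2 \<times> 2 \<Rightarrow> nat.
    modulus v = cantor_pair (modulus n) (modulus m) \<and> (\<forall>i j. v (i, j) \<le> vt (i, j))"
proof -
  have "sum vt UNIV = (\<Sum>i\<in>UNIV. \<Sum>j\<in>UNIV. vt (i, j))"
    by (simp add: sum.cartesian_product)
  also have "\<dots> = cantor_pair (n 1) (m 1) + cantor_pair (n 1) (m 2)
      + cantor_pair (n 2) (m 1) + cantor_pair (n 2) (m 2)"
    by (simp add: sum_2 assms(6))
  finally have "cantor_pair (modulus n) (modulus m) \<le> sum vt UNIV"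
    using cantor_pair_add_le[of "n 1" "n 2" "m 1" "m 2"]
    by (simp add: modulus_def sum_2)
  from exists_bounded_with_sum[OF finite this] show ?thesis
    unfolding modulus_def by blast
qed

end
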